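(* Let $k$ be an algebraically closed field. Then every quadratic algebra with one relation, $R=k\langle x_1,\dots,x_n\rangle/(f)$ with $f$ a nonzero homogeneous quadratic element, is initially Koszul (with respect to a suitable basis of $R_1$). In particular, every standard Artin–Schelter regular algebra of global dimension $2$ over $k$ is initially Koszul.
   Context: For a standard algebra $R$ (graded, $R_0=k$, generated by $R_1$) and a basis $x_1,\dots,x_n$ of $R_1$, let $I_k=x_1R+\dots+x_kR$ ($I_0=0$). $R$ is initially Koszul (with Groebner flag $(x_1,\dots,x_n)$) if for some such basis and each $1\le k\le n$ the right ideal $\{a\in R: x_ka\in I_{k-1}\}$ equals $I_j$ for some $j$ (equivalently, $\{I_0,\dots,I_n\}$ is a Koszul filtration: a family of right ideals generated in degree one, containing $0$ and $R_+$, such that each nonzero member $I$ equals $J+xR$ with $J\ne I$ in the family, $x\in R_1$, and $\{a: xa\in J\}$ in the family). *)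

theory Defs
  imports "HOL-Computational_Algebra.Polynomial"
begin

text \<open>Free associative algebra k<x_0,...,x_{n-1}>: an element is a coefficient
function on words (lists of letter indices) with finite support, all of whose
words use only letters < n.\<close>

type_synonym 'k ncpoly = "nat list \<Rightarrow> 'k"

definition free_alg :: "nat \<Rightarrow> ('k::zero) ncpoly set" where
  "free_alg n = {p. finite {w. p w \<noteq> 0} \<and> (\<forall>w. p w \<noteq> 0 \<longrightarrow> set w \<subseteq> {..<n})}"

definition ncmul :: "('k::semiring_0) ncpoly \<Rightarrow> 'k ncpoly \<Rightarrow> 'k ncpoly" where
  "ncmul p q = (\<lambda>w. \<Sum>i\<le>length w. p (take i w) * q (drop i w))"

definition ncadd :: "('k::plus) ncpoly \<Rightarrow> 'k ncpoly \<Rightarrow> 'k ncpoly" where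
  "ncadd p q = (\<lambda>w. p w + q w)"

definition homogeneous :: "nat \<Rightarrow> ('k::zero) ncpoly \<Rightarrow> bool" where
  "homogeneous d p \<longleftrightarrow> (\<forall>w. p w \<noteq> 0 \<longrightarrow> length w = d)"

definition two_sided_ideal :: "nat \<Rightarrow> ('k::comm_ring_1) ncpoly \<Rightarrow> 'k ncpoly set" where
  "two_sided_ideal n f = {p. \<exists>(m::nat) a b. (\<forall>j<m. a j \<in> free_alg n \<and> b j \<in> free_alg n) \<and>
      p = (\<lambda>w. \<Sum>j<m. ncmul (ncmul (a j) f) (b j) w)}"

text \<open>Preimage in the free algebra of the right ideal I_k = y_0 R + ... + y_{k-1} R
of R = k<x>/(f).\<close>
definition right_ideal_pre :: "nat \<Rightarrow> ('k::comm_ring_1) ncpoly \<Rightarrow> (nat \<Rightarrow> 'k ncpoly) \<Rightarrow> nat \<Rightarrow> 'k ncpoly set" where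
  "right_ideal_pre n f y k = {p. \<exists>g h. (\<forall>i<k. g i \<in> free_alg n) \<and> h \<in> two_sided_ideal n f \<and>
      p = ncadd (\<lambda>w. \<Sum>i<k. ncmul (y i) (g i) w) h}"

definition degree_one_basis :: "nat \<Rightarrow> (nat \<Rightarrow> ('k::field) ncpoly) \<Rightarrow> bool" where
  "degree_one_basis n y \<longleftrightarrow> (\<forall>i<n. y i \<in> free_alg n \<and> homogeneous 1 (y i)) \<and>
     (\<forall>c. (\<forall>w. (\<Sum>i<n. c i * y i w) = 0) \<longrightarrow> (\<forall>i<n. c i = 0))"

text \<open>R = k<x_0..x_{n-1}>/(f) is initially Koszul with Groebner flag (y_0,...,y_{n-1}):
for each k, {a in R. y_k a in I_k} = I_j for some j (0-based indices; I_k generated by y_0..y_{k-1}).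
Elements of R are represented by their preimages in the free algebra.\<close>
definition initially_koszul_wrt :: "nat \<Rightarrow> ('k::field) ncpoly \<Rightarrow> (nat \<Rightarrow> 'k ncpoly) \<Rightarrow> bool" where
  "initially_koszul_wrt n f y \<longleftrightarrow>
     (\<forall>k<n. \<exists>j\<le>n. {a \<in> free_alg n. ncmul (y k) a \<in> right_ideal_pre n f y k} = right_ideal_pre n f y j)"

definition initially_koszul :: "nat \<Rightarrow> ('k::field) ncpoly \<Rightarrow> bool" where
  "initially_koszul n f \<longleftrightarrow> (\<exists>y. degree_one_basis n y \<and> initially_koszul_wrt n f y)"

end

theory Submission
  imports Defs "Jordan_Normal_Form.Determinant" "HOL-Combinatorics.Transposition"
begin

(* Write f = \<Sum> C a b x_a x_b.  For a basis y_0, ..., y_(n-1) of the degree one part with dual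
   coordinates, every element without constant term is \<Sum> y_j (\<partial>_j h), \<partial>_j the left derivative
   along y_j; in particular f = \<Sum> y_j \<ell>_j with linear forms \<ell>_j = \<partial>_j f.  Differentiating
   y_k a = \<Sum>_(i<k) y_i g_i + h with h \<in> (f) shows a \<equiv> \<ell>_k c modulo (f) with \<ell>_j c \<in> (f) for all j > k.

   Over an algebraically closed field either some covector p with \<ell> = \<Sum> p_a \<partial>_a f \<noteq> 0 is isotropic,
   p(\<ell>) = p^T C p = 0, or f = c y^2 is a square.  In the first case choose the basis with y_0 = \<ell>
   and \<partial>_(n-1) = p, so that \<ell>_(n-1) = y_0; then y_0 is left regular in R by induction on the degree,
   and the colon ideals are I_0 for k < n - 1 and I_1 for k = n - 1.  In the second case take
   y_0 = y: then \<ell>_j = 0 for j > 0, and the colon ideals are I_1 for k = 0 and I_0 otherwise. *)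

section \<open>The free algebra\<close>

definition ncone :: "('k::{zero,one}) ncpoly" where
  "ncone = (\<lambda>w. if w = [] then 1 else 0)"

lemma sum_atMost_triangle_reindex:
  fixes g :: "nat \<Rightarrow> nat \<Rightarrow> 'a::comm_monoid_add"
  shows "(\<Sum>i\<le>L. \<Sum>j\<le>i. g i j) = (\<Sum>j\<le>L. \<Sum>k\<le>L - j. g (j + k) j)"
proof -
  have "(\<Sum>i\<le>L. \<Sum>j\<le>i. g i j) = (\<Sum>(j,k)\<in>{(j,k). j+k \<le> L}. g (j+k) j)"
    using sum.triangle_reindex_eq[of "\<lambda>j k. g (j+k) j" L] by simp
  also have "\<dots> = (\<Sum>j\<le>L. \<Sum>k\<le>L - j. g (j + k) j)"
    by (auto simp: sum.Sigma intro!: sum.cong)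
  finally show ?thesis .
qed

lemma sum_lessThan_add:
  "(\<Sum>j<m1+m2. g j) = (\<Sum>j<m1. g j) + (\<Sum>j<(m2::nat). g (m1+j)::'a::comm_monoid_add)"
  by (induction m2) (auto simp: add.assoc)

lemma ncmul_assoc: "ncmul (ncmul p q) r = ncmul p (ncmul q (r::('k::semiring_0) ncpoly))"
proof
  fix w :: "nat list"
  let ?L = "length w"
  have "ncmul (ncmul p q) r w
      = (\<Sum>i\<le>?L. \<Sum>j\<le>i. p (take j w) * q (take (i-j) (drop j w)) * r (drop i w))"
    unfolding ncmul_def by (auto simp: sum_distrib_right min_def take_drop intro!: sum.cong)
  also have "\<dots> = (\<Sum>j\<le>?L. \<Sum>k\<le>?L - j. p (take j w) * q (take k (drop j w)) * r (drop (j+k) w))"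
    by (subst sum_atMost_triangle_reindex) simp
  also have "\<dots> = ncmul p (ncmul q r) w"
    unfolding ncmul_def by (auto simp: sum_distrib_left mult.assoc add.commute intro!: sum.cong)
  finally show "ncmul (ncmul p q) r w = ncmul p (ncmul q r) w" .
qed

lemma ncmul_ncone_left [simp]: "ncmul ncone p = (p::('k::semiring_1) ncpoly)"
proof
  fix w show "ncmul ncone p w = p w"
    unfolding ncmul_def ncone_def by (simp add: sum.atMost_shift)
qed

lemma ncmul_ncone_right [simp]: "ncmul p ncone = (p::('k::semiring_1) ncpoly)"
proof
  fix w
  have "ncmul p ncone w = (\<Sum>i\<le>length w. if i = length w then p w else 0)"
    unfolding ncmul_def ncone_def by (intro sum.cong) auto
  then show "ncmul p ncone w = p w" by simp
qed

lemma ncmul_sum_left: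
  "ncmul (\<lambda>w. \<Sum>j\<in>J. X j w) q = (\<lambda>w. \<Sum>j\<in>J. ncmul (X j) (q::('k::semiring_0) ncpoly) w)"
  unfolding ncmul_def by (auto simp: sum_distrib_right intro: sum.swap)

lemma ncmul_sum_right:
  "ncmul q (\<lambda>w. \<Sum>j\<in>J. X j w) = (\<lambda>w. \<Sum>j\<in>J. ncmul (q::('k::semiring_0) ncpoly) (X j) w)"
  unfolding ncmul_def by (auto simp: sum_distrib_left intro: sum.swap)

lemma ncmul_add_left:
  "ncmul (\<lambda>w. p w + p' w) q = (\<lambda>w. ncmul p q w + ncmul p' (q::('k::semiring_0) ncpoly) w)"
  unfolding ncmul_def by (auto simp: distrib_right sum.distrib)

lemma ncmul_add_right:
  "ncmul q (\<lambda>w. p w + p' w) = (\<lambda>w. ncmul q p w + ncmul (q::('k::semiring_0) ncpoly) p' w)"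
  unfolding ncmul_def by (auto simp: distrib_left sum.distrib)

lemma ncmul_smult_left:
  "ncmul (\<lambda>w. c * p w) q = (\<lambda>w. c * ncmul p (q::('k::comm_semiring_0) ncpoly) w)"
  unfolding ncmul_def by (auto simp: sum_distrib_left mult.assoc)

lemma ncmul_smult_right:
  "ncmul q (\<lambda>w. c * p w) = (\<lambda>w. c * ncmul (q::('k::comm_semiring_0) ncpoly) p w)"
  unfolding ncmul_def by (auto simp: sum_distrib_left mult.left_commute)

lemma ncmul_zero_left [simp]: "ncmul (\<lambda>w. 0) q = (\<lambda>w. 0::'k::semiring_0)"
  unfolding ncmul_def by auto

lemma ncmul_zero_right [simp]: "ncmul q (\<lambda>w. 0) = (\<lambda>w. 0::'k::semiring_0)"
  unfolding ncmul_def by auto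

lemma ncmul_uminus_right:
  "ncmul q (\<lambda>w. - p w) = (\<lambda>w. - ncmul (q::('k::ring) ncpoly) p w)"
  unfolding ncmul_def by (auto simp: sum_negf)

lemma ncmul_Nil: "ncmul p q [] = p [] * (q [] :: 'k::semiring_0)"
  unfolding ncmul_def by simp

lemma ncmul_Cons:
  "ncmul p q (i # w) = p [] * q (i # w) + (\<Sum>s\<le>length w. p (i # take s w) * (q (drop s w) :: 'k::semiring_0))"
  unfolding ncmul_def length_Cons sum.atMost_Suc_shift by simp

lemma free_algI:
  assumes "finite {w. p w \<noteq> 0}" "\<And>w. p w \<noteq> 0 \<Longrightarrow> set w \<subseteq> {..<n}"
  shows "p \<in> free_alg n"
  using assms unfolding free_alg_def by auto

lemma free_alg_finite_support: "p \<in> free_alg n \<Longrightarrow> finite {w. p w \<noteq> 0}"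
  unfolding free_alg_def by auto

lemma free_alg_letters: "p \<in> free_alg n \<Longrightarrow> p w \<noteq> 0 \<Longrightarrow> set w \<subseteq> {..<n}"
  unfolding free_alg_def by auto

lemma free_alg_support_subset:
  assumes "q \<in> free_alg n" "\<And>w. p w \<noteq> 0 \<Longrightarrow> q w \<noteq> 0"
  shows "p \<in> free_alg n"
proof (rule free_algI)
  show "finite {w. p w \<noteq> 0}"
    using free_alg_finite_support[OF assms(1)] by (rule finite_subset[rotated]) (auto dest: assms(2))
qed (use assms free_alg_letters in blast)

lemma free_alg_zero [simp]: "(\<lambda>w. 0) \<in> free_alg n"
  by (rule free_algI) auto

lemma free_alg_ncone [simp]: "(ncone::'k::zero_neq_one ncpoly) \<in> free_alg n"
  by (rule free_algI) (auto simp: ncone_def split: if_splits)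

lemma free_alg_add:
  fixes p q :: "('k::monoid_add) ncpoly"
  assumes "p \<in> free_alg n" "q \<in> free_alg n"
  shows "(\<lambda>w. p w + q w) \<in> free_alg n"
proof (rule free_algI)
  have "{w. p w + q w \<noteq> 0} \<subseteq> {w. p w \<noteq> 0} \<union> {w. q w \<noteq> 0}" by auto
  then show "finite {w. p w + q w \<noteq> 0}"
    using assms by (blast intro: finite_subset free_alg_finite_support)
  fix w assume "p w + q w \<noteq> 0"
  then have "p w \<noteq> 0 \<or> q w \<noteq> 0" by auto
  then show "set w \<subseteq> {..<n}" using assms free_alg_letters by blast
qed

lemma free_alg_smult:
  "p \<in> free_alg n \<Longrightarrow> (\<lambda>w. c * p w) \<in> free_alg n" for p :: "('k::semiring_0) ncpoly"
  by (erule free_alg_support_subset) auto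

lemma free_alg_uminus:
  "p \<in> free_alg n \<Longrightarrow> (\<lambda>w. - p w) \<in> free_alg n" for p :: "('k::group_add) ncpoly"
  by (erule free_alg_support_subset) auto

lemma free_alg_sum:
  fixes X :: "'j \<Rightarrow> ('k::comm_monoid_add) ncpoly"
  assumes "finite J" "\<And>j. j \<in> J \<Longrightarrow> X j \<in> free_alg n"
  shows "(\<lambda>w. \<Sum>j\<in>J. X j w) \<in> free_alg n"
  using assms by (induction J rule: finite_induct) (auto intro: free_alg_add)

lemma ncmul_nonzero_split:
  assumes "ncmul p q w \<noteq> 0"
  obtains i where "p (take i w) \<noteq> 0" "q (drop i w) \<noteq> (0::'k::semiring_0)"
proof -
  obtain i where "p (take i w) * q (drop i w) \<noteq> 0"
    using assms unfolding ncmul_def by (auto elim: sum.not_neutral_contains_not_neutral)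
  then show thesis using that by (metis mult_zero_left mult_zero_right)
qed

lemma free_alg_ncmul:
  fixes p q :: "('k::semiring_0) ncpoly"
  assumes "p \<in> free_alg n" "q \<in> free_alg n"
  shows "ncmul p q \<in> free_alg n"
proof (rule free_algI)
  have "{w. ncmul p q w \<noteq> 0} \<subseteq> (\<lambda>(u,v). u @ v) ` ({w. p w \<noteq> 0} \<times> {w. q w \<noteq> 0})"
  proof
    fix w assume "w \<in> {w. ncmul p q w \<noteq> 0}"
    then obtain i where "p (take i w) \<noteq> 0" "q (drop i w) \<noteq> 0"
      by (auto elim: ncmul_nonzero_split)
    then show "w \<in> (\<lambda>(u,v). u @ v) ` ({w. p w \<noteq> 0} \<times> {w. q w \<noteq> 0})"
      by (intro image_eqI[of _ _ "(take i w, drop i w)"]) auto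
  qed
  then show "finite {w. ncmul p q w \<noteq> 0}"
    using assms by (blast intro: finite_subset free_alg_finite_support)
  fix w assume "ncmul p q w \<noteq> 0"
  then obtain i where "p (take i w) \<noteq> 0" "q (drop i w) \<noteq> 0"
    by (auto elim: ncmul_nonzero_split)
  then have "set (take i w) \<union> set (drop i w) \<subseteq> {..<n}"
    using assms free_alg_letters by blast
  then show "set w \<subseteq> {..<n}"
    by (metis append_take_drop_id set_append)
qed

section \<open>The two-sided ideal generated by the relation\<close>

lemma two_sided_idealI:
  fixes m :: nat
  assumes "\<forall>j<m. a j \<in> free_alg n \<and> b j \<in> free_alg n"
  shows "(\<lambda>w. \<Sum>j<m. ncmul (ncmul (a j) f) (b j) w) \<in> two_sided_ideal n f"
  using assms unfolding two_sided_ideal_def by blast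

lemma two_sided_idealE:
  assumes "p \<in> two_sided_ideal n f"
  obtains m :: nat and a b where "\<forall>j<m. a j \<in> free_alg n \<and> b j \<in> free_alg n"
    "p = (\<lambda>w. \<Sum>j<m. ncmul (ncmul (a j) f) (b j) w)"
  using assms unfolding two_sided_ideal_def by blast

context
  fixes n :: nat and f :: "('k::comm_ring_1) ncpoly"
begin

lemma two_sided_ideal_zero [simp]: "(\<lambda>w. 0) \<in> two_sided_ideal n f"
  using two_sided_idealI[where m = 0 and n = n and f = f] by simp

lemma two_sided_ideal_generator: "f \<in> two_sided_ideal n f"
  using two_sided_idealI[of 1 "\<lambda>_. ncone" n "\<lambda>_. ncone" f] by (simp add: card_lessThan)

lemma two_sided_ideal_add:
  assumes "p \<in> two_sided_ideal n f" "q \<in> two_sided_ideal n f"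
  shows "(\<lambda>w. p w + q w) \<in> two_sided_ideal n f"
proof -
  obtain m1 :: nat and a1 b1 where 1: "\<forall>j<m1. a1 j \<in> free_alg n \<and> b1 j \<in> free_alg n"
    "p = (\<lambda>w. \<Sum>j<m1. ncmul (ncmul (a1 j) f) (b1 j) w)" using assms(1) by (rule two_sided_idealE)
  obtain m2 :: nat and a2 b2 where 2: "\<forall>j<m2. a2 j \<in> free_alg n \<and> b2 j \<in> free_alg n"
    "q = (\<lambda>w. \<Sum>j<m2. ncmul (ncmul (a2 j) f) (b2 j) w)" using assms(2) by (rule two_sided_idealE)
  define a where "a j = (if j < m1 then a1 j else a2 (j - m1))" for j
  define b where "b j = (if j < m1 then b1 j else b2 (j - m1))" for j
  have "(\<lambda>w. \<Sum>j<m1+m2. ncmul (ncmul (a j) f) (b j) w) \<in> two_sided_ideal n f"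
    by (rule two_sided_idealI) (use 1 2 in \<open>auto simp: a_def b_def\<close>)
  also have "(\<lambda>w. \<Sum>j<m1+m2. ncmul (ncmul (a j) f) (b j) w) = (\<lambda>w. p w + q w)"
    unfolding sum_lessThan_add 1 2 by (auto simp: a_def b_def)
  finally show ?thesis .
qed

lemma two_sided_ideal_smult:
  assumes "p \<in> two_sided_ideal n f"
  shows "(\<lambda>w. c * p w) \<in> two_sided_ideal n f"
proof -
  obtain m :: nat and a b where 1: "\<forall>j<m. a j \<in> free_alg n \<and> b j \<in> free_alg n"
    "p = (\<lambda>w. \<Sum>j<m. ncmul (ncmul (a j) f) (b j) w)" using assms(1) by (rule two_sided_idealE)
  have "(\<lambda>w. \<Sum>j<m. ncmul (ncmul (\<lambda>w. c * a j w) f) (b j) w) \<in> two_sided_ideal n f"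
    by (rule two_sided_idealI) (use 1 in \<open>auto intro: free_alg_smult\<close>)
  then show ?thesis
    unfolding 1 ncmul_smult_left by (simp add: sum_distrib_left)
qed

lemma two_sided_ideal_sum:
  assumes "finite J" "\<And>j. j \<in> J \<Longrightarrow> X j \<in> two_sided_ideal n f"
  shows "(\<lambda>w. \<Sum>j\<in>J. X j w) \<in> two_sided_ideal n f"
  using assms by (induction J rule: finite_induct) (auto intro: two_sided_ideal_add)

lemma two_sided_ideal_ncmul_left:
  assumes "g \<in> free_alg n" "p \<in> two_sided_ideal n f"
  shows "ncmul g p \<in> two_sided_ideal n f"
proof -
  obtain m :: nat and a b where 1: "\<forall>j<m. a j \<in> free_alg n \<and> b j \<in> free_alg n"
    "p = (\<lambda>w. \<Sum>j<m. ncmul (ncmul (a j) f) (b j) w)" using assms(2) by (rule two_sided_idealE)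
  have "(\<lambda>w. \<Sum>j<m. ncmul (ncmul (ncmul g (a j)) f) (b j) w) \<in> two_sided_ideal n f"
    by (rule two_sided_idealI) (use 1 assms(1) in \<open>auto intro: free_alg_ncmul\<close>)
  then show ?thesis
    unfolding 1 ncmul_sum_right by (simp add: ncmul_assoc)
qed

lemma two_sided_ideal_ncmul_right:
  assumes "g \<in> free_alg n" "p \<in> two_sided_ideal n f"
  shows "ncmul p g \<in> two_sided_ideal n f"
proof -
  obtain m :: nat and a b where 1: "\<forall>j<m. a j \<in> free_alg n \<and> b j \<in> free_alg n"
    "p = (\<lambda>w. \<Sum>j<m. ncmul (ncmul (a j) f) (b j) w)" using assms(2) by (rule two_sided_idealE)
  have "(\<lambda>w. \<Sum>j<m. ncmul (ncmul (a j) f) (ncmul (b j) g) w) \<in> two_sided_ideal n f"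
    by (rule two_sided_idealI) (use 1 assms(1) in \<open>auto intro: free_alg_ncmul\<close>)
  then show ?thesis
    unfolding 1 ncmul_sum_left by (simp add: ncmul_assoc)
qed

lemma two_sided_ideal_subset_free_alg:
  assumes "f \<in> free_alg n"
  shows "two_sided_ideal n f \<subseteq> free_alg n"
proof
  fix p assume "p \<in> two_sided_ideal n f"
  then obtain m :: nat and a b where 1: "\<forall>j<m. a j \<in> free_alg n \<and> b j \<in> free_alg n"
    "p = (\<lambda>w. \<Sum>j<m. ncmul (ncmul (a j) f) (b j) w)" by (rule two_sided_idealE)
  show "p \<in> free_alg n"
    unfolding 1(2) by (rule free_alg_sum) (use 1(1) assms in \<open>auto intro!: free_alg_ncmul\<close>)
qed

end

section \<open>Homogeneous components\<close>

definition homogeneous_part :: "nat \<Rightarrow> ('k::zero) ncpoly \<Rightarrow> 'k ncpoly" where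
  "homogeneous_part d p = (\<lambda>w. if length w = d then p w else 0)"

lemma homogeneous_part_sum:
  "homogeneous_part d (\<lambda>w. \<Sum>t\<in>T. X t w) = (\<lambda>w. \<Sum>t\<in>T. homogeneous_part d (X t) w :: 'k::comm_monoid_add)"
  unfolding homogeneous_part_def by auto

lemma free_alg_homogeneous_part: "p \<in> free_alg n \<Longrightarrow> homogeneous_part d p \<in> free_alg n"
  by (erule free_alg_support_subset) (auto simp: homogeneous_part_def split: if_splits)

lemma homogeneous_part_homogeneous:
  "homogeneous e p \<Longrightarrow> homogeneous_part d p = (if d = e then p else (\<lambda>w. 0))"
  unfolding homogeneous_part_def homogeneous_def by (auto intro!: ext)

lemma homogeneous_part_ncmul:
  "homogeneous_part d (ncmul p q)
     = (\<lambda>w. \<Sum>i\<le>d. ncmul (homogeneous_part i p) (homogeneous_part (d - i) q) w :: 'k::semiring_0)"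
proof
  fix w
  have "(\<Sum>i\<le>d. ncmul (homogeneous_part i p) (homogeneous_part (d - i) q) w)
      = (\<Sum>i\<le>d. \<Sum>s\<le>length w. if s = i \<and> length w = d then p (take s w) * q (drop s w) else 0)"
    unfolding ncmul_def homogeneous_part_def by (intro sum.cong refl) auto
  also have "\<dots> = (\<Sum>s\<le>length w. \<Sum>i\<le>d. if s = i \<and> length w = d then p (take s w) * q (drop s w) else 0)"
    by (rule sum.swap)
  also have "\<dots> = homogeneous_part d (ncmul p q) w"
    unfolding homogeneous_part_def ncmul_def by (auto intro!: sum.cong)
  finally show "homogeneous_part d (ncmul p q) w
      = (\<Sum>i\<le>d. ncmul (homogeneous_part i p) (homogeneous_part (d - i) q) w)" ..
qed

lemma free_alg_sum_homogeneous_parts: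
  assumes "p \<in> free_alg n"
  obtains N where "p = (\<lambda>w. \<Sum>d\<le>N. homogeneous_part d p w)"
proof -
  obtain N where N: "\<forall>m \<in> length ` {w. p w \<noteq> 0}. m \<le> N"
    using free_alg_finite_support[OF assms] finite_nat_set_iff_bounded_le by blast
  have "p w = (\<Sum>d\<le>N. homogeneous_part d p w)" for w
  proof (cases "length w \<le> N")
    case True
    then have "(\<Sum>d\<le>N. homogeneous_part d p w) = (\<Sum>d\<le>N. if d = length w then p w else 0)"
      unfolding homogeneous_part_def by (intro sum.cong) auto
    then show ?thesis using True by simp
  qed (use N in \<open>auto simp: homogeneous_part_def\<close>)
  then show ?thesis using that by blast
qed

context
  fixes n :: nat and f :: "('k::comm_ring_1) ncpoly"
begin

lemma two_sided_ideal_homogeneous_part: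
  assumes "homogeneous e f" "h \<in> two_sided_ideal n f"
  shows "homogeneous_part d h \<in> two_sided_ideal n f"
proof -
  obtain m :: nat and a b where 1: "\<forall>t<m. a t \<in> free_alg n \<and> b t \<in> free_alg n"
    "h = (\<lambda>w. \<Sum>t<m. ncmul (ncmul (a t) f) (b t) w)" using assms(2) by (rule two_sided_idealE)
  have f_part: "homogeneous_part i f \<in> two_sided_ideal n f" for i
    using homogeneous_part_homogeneous[OF assms(1), of i] two_sided_ideal_generator by auto
  show ?thesis
    unfolding 1 homogeneous_part_sum homogeneous_part_ncmul ncmul_sum_left
    by (intro two_sided_ideal_sum finite_lessThan finite_atMost two_sided_ideal_ncmul_left
        two_sided_ideal_ncmul_right free_alg_homogeneous_part f_part) (use 1 in auto)
qed

lemma two_sided_idealI_homogeneous_parts: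
  assumes "h \<in> free_alg n" "\<And>d. homogeneous_part d h \<in> two_sided_ideal n f"
  shows "h \<in> two_sided_ideal n f"
proof -
  obtain N where "h = (\<lambda>w. \<Sum>d\<le>N. homogeneous_part d h w)"
    using free_alg_sum_homogeneous_parts[OF assms(1)] by blast
  also have "\<dots> \<in> two_sided_ideal n f" by (intro two_sided_ideal_sum assms(2)) auto
  finally show ?thesis .
qed

end

section \<open>Linear forms and left derivatives\<close>

definition linform :: "nat \<Rightarrow> (nat \<Rightarrow> 'k::zero) \<Rightarrow> 'k ncpoly" where
  "linform n v = (\<lambda>w. case w of [a] \<Rightarrow> if a < n then v a else 0 | _ \<Rightarrow> 0)"

definition left_deriv :: "nat \<Rightarrow> (nat \<Rightarrow> 'k::semiring_0) \<Rightarrow> 'k ncpoly \<Rightarrow> 'k ncpoly" where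
  "left_deriv n u p = (\<lambda>w. \<Sum>i<n. u i * p (i # w))"

lemma linform_nonzero: "linform n v w \<noteq> 0 \<Longrightarrow> \<exists>a<n. w = [a]"
  unfolding linform_def by (cases w; cases "tl w") (auto split: if_splits)

lemma linform_Cons: "linform n v (a # w) = (if w = [] \<and> a < n then v a else 0)"
  unfolding linform_def by (auto split: list.splits)

lemma linform_cong: "(\<And>a. a < n \<Longrightarrow> u a = v a) \<Longrightarrow> linform n u = linform n v"
  unfolding linform_def by (auto split: list.splits)

lemma linform_zero: "linform n (\<lambda>a. 0) = (\<lambda>w. 0)"
  unfolding linform_def by (auto split: list.splits)

lemma linform_smult: "linform n (\<lambda>a. c * v a) = (\<lambda>w. c * linform n v w :: 'k::semiring_0)"
  unfolding linform_def by (auto split: list.splits)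

lemma free_alg_linform: "linform n v \<in> free_alg n"
proof (rule free_algI)
  have "{w. linform n v w \<noteq> 0} \<subseteq> (\<lambda>a. [a]) ` {..<n}"
    using linform_nonzero by fastforce
  then show "finite {w. linform n v w \<noteq> 0}" by (rule finite_subset) auto
qed (use linform_nonzero in fastforce)

lemma homogeneous_linform: "homogeneous 1 (linform n v)"
  unfolding homogeneous_def using linform_nonzero by fastforce

lemma ncmul_linform_Nil: "ncmul (linform n v) q [] = (0::'k::semiring_0)"
  by (simp add: ncmul_Nil linform_def)

lemma ncmul_linform_Cons:
  "ncmul (linform n v) q (a # w) = (if a < n then v a else 0) * (q w :: 'k::semiring_0)"
proof -
  have "(\<Sum>s\<le>length w. linform n v (a # take s w) * q (drop s w))
      = (\<Sum>s\<le>length w. if s = 0 then (if a < n then v a else 0) * q w else 0)"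
    by (rule sum.cong) (auto simp: linform_Cons)
  then show ?thesis
    unfolding ncmul_Cons by (simp add: linform_def)
qed

lemma homogeneous_part_linform_ncmul:
  "homogeneous_part d (ncmul (linform n v) c)
     = (if d = 0 then (\<lambda>w. 0) else ncmul (linform n v) (homogeneous_part (d - 1) c :: ('k::semiring_0) ncpoly))"
proof
  fix w show "homogeneous_part d (ncmul (linform n v) c) w
      = (if d = 0 then (\<lambda>w. 0) else ncmul (linform n v) (homogeneous_part (d - 1) c)) w"
    by (cases w) (auto simp: homogeneous_part_def ncmul_linform_Nil ncmul_linform_Cons)
qed

lemma left_deriv_add: "left_deriv n u (\<lambda>w. p w + q w) = (\<lambda>w. left_deriv n u p w + left_deriv n u q w)"
  unfolding left_deriv_def by (simp add: distrib_left sum.distrib)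

lemma left_deriv_sum: "left_deriv n u (\<lambda>w. \<Sum>t\<in>T. X t w) = (\<lambda>w. \<Sum>t\<in>T. left_deriv n u (X t) w)"
  unfolding left_deriv_def by (simp add: sum_distrib_left sum.swap[of _ T])

lemma free_alg_left_deriv:
  assumes "p \<in> free_alg n"
  shows "left_deriv n u p \<in> free_alg n"
proof (rule free_algI)
  have nonzero: "\<exists>i. p (i # w) \<noteq> 0" if "left_deriv n u p w \<noteq> 0" for w
    using that unfolding left_deriv_def by (rule contrapos_np) simp
  then have "{w. left_deriv n u p w \<noteq> 0} \<subseteq> tl ` {w. p w \<noteq> 0}"
    by (force intro: image_eqI[where x = "_ # _"])
  then show "finite {w. left_deriv n u p w \<noteq> 0}"
    using assms by (blast intro: finite_subset free_alg_finite_support)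
  fix w assume "left_deriv n u p w \<noteq> 0"
  then show "set w \<subseteq> {..<n}"
    using nonzero free_alg_letters[OF assms] by fastforce
qed

lemma left_deriv_ncmul:
  "left_deriv n u (ncmul p q) = (\<lambda>w. ncmul (left_deriv n u p) q w + p [] * left_deriv n u q w)"
  for p q :: "('k::comm_semiring_0) ncpoly"
proof
  fix w
  have "(\<Sum>i<n. u i * (p [] * q (i # w))) = p [] * left_deriv n u q w"
    by (simp add: left_deriv_def sum_distrib_left mult.left_commute)
  moreover have "(\<Sum>i<n. u i * (\<Sum>s\<le>length w. p (i # take s w) * q (drop s w)))
      = ncmul (left_deriv n u p) q w"
    unfolding ncmul_def left_deriv_def
    by (simp add: sum_distrib_left sum_distrib_right mult.assoc sum.swap[of _ "{..<n}"])
  ultimately show "left_deriv n u (ncmul p q) w = ncmul (left_deriv n u p) q w + p [] * left_deriv n u q w"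
    unfolding left_deriv_def ncmul_Cons by (simp add: distrib_left sum.distrib add.commute)
qed

lemma left_deriv_linform_ncmul:
  "left_deriv n u (ncmul (linform n v) q) = (\<lambda>w. (\<Sum>i<n. u i * v i) * q w)"
  unfolding left_deriv_def ncmul_linform_Cons by (simp add: sum_distrib_right mult.assoc)

text \<open>Differentiating \<open>\<Sum> a\<^sub>t f b\<^sub>t\<close> gives \<open>\<Sum> (\<partial>a\<^sub>t) f b\<^sub>t + (\<partial>f) c\<close> with \<open>c = \<Sum> a\<^sub>t[] b\<^sub>t\<close>
  (\<open>a\<^sub>t[]\<close> the constant term), and \<open>c\<close> does not depend on the direction \<open>u\<close>.\<close>

lemma two_sided_ideal_left_deriv:
  fixes f :: "('k::comm_ring_1) ncpoly"
  assumes "f [] = 0" "h \<in> two_sided_ideal n f"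
  obtains c where "c \<in> free_alg n"
    "\<And>u. (\<lambda>w. left_deriv n u h w - ncmul (left_deriv n u f) c w) \<in> two_sided_ideal n f"
proof -
  obtain m :: nat and a b where 1: "\<forall>t<m. a t \<in> free_alg n \<and> b t \<in> free_alg n"
    "h = (\<lambda>w. \<Sum>t<m. ncmul (ncmul (a t) f) (b t) w)" using assms(2) by (rule two_sided_idealE)
  define c where "c = (\<lambda>w. \<Sum>t<m. a t [] * b t w)"
  have "c \<in> free_alg n" unfolding c_def
    by (rule free_alg_sum) (use 1 in \<open>auto intro: free_alg_smult\<close>)
  moreover have "(\<lambda>w. left_deriv n u h w - ncmul (left_deriv n u f) c w) \<in> two_sided_ideal n f" for u
  proof -
    have "(\<lambda>w. left_deriv n u h w - ncmul (left_deriv n u f) c w)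
       = (\<lambda>w. \<Sum>t<m. ncmul (ncmul (left_deriv n u (a t)) f) (b t) w)"
      unfolding 1 left_deriv_sum c_def left_deriv_ncmul ncmul_sum_right ncmul_smult_right
      by (simp add: ncmul_Nil assms(1) ncmul_add_left ncmul_smult_left sum.distrib)
    also have "\<dots> \<in> two_sided_ideal n f"
      by (rule two_sided_idealI) (use 1 in \<open>auto intro: free_alg_left_deriv\<close>)
    finally show ?thesis .
  qed
  ultimately show ?thesis using that by blast
qed

lemma homogeneous2_support:
  assumes "f \<in> free_alg n" "homogeneous 2 f" "f w \<noteq> 0"
  shows "\<exists>a b. w = [a, b] \<and> a < n \<and> b < n"
proof -
  have "length w = 2" using assms unfolding homogeneous_def by blast
  moreover have "set w \<subseteq> {..<n}" using free_alg_letters[OF assms(1,3)] .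
  ultimately show ?thesis
    by (cases w; cases "tl w"; cases "tl (tl w)") auto
qed

lemma homogeneous2_Nil: "homogeneous 2 f \<Longrightarrow> f [] = 0"
  unfolding homogeneous_def by force

lemma left_deriv_quadratic:
  assumes "f \<in> free_alg n" "homogeneous 2 f"
  shows "left_deriv n u f = linform n (\<lambda>b. \<Sum>a<n. u a * f [a, b])"
proof
  fix w
  show "left_deriv n u f w = linform n (\<lambda>b. \<Sum>a<n. u a * f [a, b]) w"
  proof (cases "\<exists>b<n. w = [b]")
    case False
    then have "f (i # w) = 0" for i
      using homogeneous2_support[OF assms] by blast
    with False show ?thesis
      unfolding left_deriv_def using linform_nonzero by fastforce
  qed (auto simp: left_deriv_def linform_def)
qed

section \<open>Dual bases of the degree one part\<close>

definition inverse_matrices :: "nat \<Rightarrow> (nat \<Rightarrow> nat \<Rightarrow> 'k::field) \<Rightarrow> (nat \<Rightarrow> nat \<Rightarrow> 'k) \<Rightarrow> bool" where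
  "inverse_matrices n D Y \<longleftrightarrow> (\<forall>j<n. \<forall>k<n. (\<Sum>i<n. D j i * Y i k) = of_bool (j = k))"

lemma inverse_matrices_commute:
  assumes "inverse_matrices n D Y"
  shows "inverse_matrices n Y D"
proof -
  define A where "A = mat n n (\<lambda>(i,j). D i j)"
  define B where "B = mat n n (\<lambda>(i,j). Y i j)"
  have A: "A \<in> carrier_mat n n" and B: "B \<in> carrier_mat n n" unfolding A_def B_def by auto
  have "A * B = 1\<^sub>m n"
    by (rule eq_matI)
      (use assms in \<open>auto simp: A_def B_def scalar_prod_def atLeast0LessThan inverse_matrices_def\<close>)
  then have "B * A = 1\<^sub>m n" by (rule mat_mult_left_right_inverse[OF A B])
  moreover have "(\<Sum>j<n. Y a j * D j b) = (B * A) $$ (a, b)" if "a < n" "b < n" for a b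
    using that by (auto simp: A_def B_def scalar_prod_def atLeast0LessThan)
  ultimately show ?thesis unfolding inverse_matrices_def by (simp add: of_bool_def)
qed

text \<open>\<open>Y\<close> holds the coordinates of a basis \<open>y\<^sub>0, \<dots>, y\<^sub>n\<^sub>-\<^sub>1\<close> of the degree one part in its columns
  and \<open>D\<close> those of the dual basis in its rows; \<open>deriv j\<close> is the left derivative along \<open>y\<^sub>j\<close>.\<close>

locale dual_bases =
  fixes n :: nat and Y D :: "nat \<Rightarrow> nat \<Rightarrow> 'k::field"
  assumes D_Y: "inverse_matrices n D Y"
begin

abbreviation y :: "nat \<Rightarrow> 'k ncpoly" where
  "y k \<equiv> linform n (\<lambda>a. Y a k)"

abbreviation deriv :: "nat \<Rightarrow> 'k ncpoly \<Rightarrow> 'k ncpoly" where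
  "deriv j \<equiv> left_deriv n (D j)"

lemma deriv_y_ncmul:
  "j < n \<Longrightarrow> k < n \<Longrightarrow> deriv j (ncmul (y k) q) = (if j = k then q else (\<lambda>w. 0))"
  using D_Y unfolding left_deriv_linform_ncmul inverse_matrices_def by auto

lemma deriv_sum_y_ncmul:
  assumes "j < n" "k \<le> n"
  shows "deriv j (\<lambda>w. \<Sum>i<k. ncmul (y i) (g i) w) = (if j < k then g j else (\<lambda>w. 0))"
proof -
  have "deriv j (\<lambda>w. \<Sum>i<k. ncmul (y i) (g i) w) = (\<lambda>w. \<Sum>i<k. if j = i then g i w else 0)"
    unfolding left_deriv_sum using assms by (intro ext sum.cong refl) (auto simp: deriv_y_ncmul)
  then show ?thesis by (auto intro!: ext)
qed

lemma degree_one_basis: "degree_one_basis n y"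
  unfolding degree_one_basis_def
proof (intro conjI allI impI)
  fix c :: "nat \<Rightarrow> 'k" and j
  assume c: "\<forall>w. (\<Sum>i<n. c i * y i w) = 0" and j: "j < n"
  have "c j = (\<Sum>k<n. c k * (\<Sum>a<n. D j a * Y a k))"
    using D_Y j by (simp add: inverse_matrices_def)
  also have "\<dots> = (\<Sum>k<n. \<Sum>a<n. c k * (D j a * Y a k))"
    by (simp add: sum_distrib_left)
  also have "\<dots> = (\<Sum>a<n. D j a * (\<Sum>k<n. c k * y k [a]))"
    by (subst sum.swap) (simp add: linform_def sum_distrib_left mult.left_commute)
  also have "\<dots> = 0" using c by simp
  finally show "c j = 0" .
qed (rule free_alg_linform homogeneous_linform)+

lemma sum_y_ncmul_deriv:
  assumes "p \<in> free_alg n" "p [] = 0"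
  shows "p = (\<lambda>w. \<Sum>j<n. ncmul (y j) (deriv j p) w)"
proof
  fix w
  show "p w = (\<Sum>j<n. ncmul (y j) (deriv j p) w)"
  proof (cases w)
    case (Cons x v)
    show ?thesis
    proof (cases "x < n")
      case True
      have "(\<Sum>j<n. ncmul (y j) (deriv j p) w) = (\<Sum>j<n. \<Sum>i<n. Y x j * D j i * p (i # v))"
        unfolding Cons ncmul_linform_Cons left_deriv_def using True
        by (simp add: sum_distrib_left mult.assoc)
      also have "\<dots> = (\<Sum>i<n. (\<Sum>j<n. Y x j * D j i) * p (i # v))"
        by (subst sum.swap) (simp add: sum_distrib_right)
      also have "\<dots> = p w"
        using inverse_matrices_commute[OF D_Y] True Cons by (simp add: inverse_matrices_def)
      finally show ?thesis ..
    next
      case False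
      then have "p w = 0" using free_alg_letters[OF assms(1)] Cons by fastforce
      then show ?thesis using False unfolding Cons ncmul_linform_Cons by simp
    qed
  qed (simp add: assms(2) ncmul_linform_Nil)
qed

end

section \<open>Choosing the basis\<close>

lemma sum_lessThan_involution:
  assumes "\<forall>a<n. \<tau> a < n \<and> \<tau> (\<tau> a) = a"
  shows "(\<Sum>a<n. g (\<tau> a)) = (\<Sum>a<n. g a :: 'a::comm_monoid_add)"
  by (rule sum.reindex_bij_witness[of _ \<tau> \<tau>]) (use assms in auto)

lemma inverse_matrices_relabel:
  assumes "inverse_matrices n D Y" "\<forall>a<n. \<tau> a < n \<and> \<tau> (\<tau> a) = a"
  shows "inverse_matrices n (\<lambda>j a. D j (\<tau> a)) (\<lambda>a k. Y (\<tau> a) k)"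
proof -
  have "(\<Sum>i<n. D j (\<tau> i) * Y (\<tau> i) k) = (\<Sum>i<n. D j i * Y i k)" for j k
    using sum_lessThan_involution[OF assms(2), of "\<lambda>i. D j i * Y i k"] .
  then show ?thesis using assms(1) unfolding inverse_matrices_def by simp
qed

lemma transpose_involution:
  "a < n \<Longrightarrow> b < n \<Longrightarrow> \<forall>c<n. transpose a b c < n \<and> transpose a b (transpose a b c) = c"
  by (simp add: transpose_def)

lemma inverse_matrices_normal_form:
  fixes p v :: "nat \<Rightarrow> 'k::field"
  assumes "0 < n - 1" "v 0 \<noteq> 0" "p (n - 1) \<noteq> 0" "(\<Sum>a<n. p a * v a) = 0"
  shows "\<exists>Y D. inverse_matrices n D Y \<and> (\<forall>a<n. Y a 0 = v a) \<and> (\<forall>a<n. D (n - 1) a = p a)"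
proof -
  define N where "N = n - 1"
  have N: "0 < N" "N < n" using assms(1) by (auto simp: N_def)
  define Y where "Y a k = (if k = 0 then v a else if k = N then of_bool (a = N) / p N
      else of_bool (a = k) - of_bool (a = N) * (p k / p N))" for a k
  define D where "D j a = (if j = 0 then of_bool (a = 0) / v 0 else if j = N then p a
      else of_bool (a = j) - of_bool (a = 0) * (v j / v 0))" for j a
  have row_p: "(\<Sum>a<n. p a * Y a k) = of_bool (k = N)" if "k < n" for k
  proof -
    consider "k = 0" | "k = N" | "k \<noteq> 0" "k \<noteq> N" by blast
    then show ?thesis
    proof cases
      case 1
      then show ?thesis using N assms(4) by (simp add: Y_def)
    next
      case 2
      then have "(\<Sum>a<n. p a * Y a k) = (\<Sum>a<n. if a = N then 1 else 0)"
        using N assms(3) by (intro sum.cong) (auto simp: Y_def N_def)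
      then show ?thesis using 2 N by simp
    next
      case 3
      then have "(\<Sum>a<n. p a * Y a k)
          = (\<Sum>a<n. (if a = k then p k else 0) - (if a = N then p N * (p k / p N) else 0))"
        by (intro sum.cong) (auto simp: Y_def)
      then show ?thesis using 3 N that assms(3) by (simp add: sum_subtractf N_def)
    qed
  qed
  have "(\<Sum>a<n. D j a * Y a k) = of_bool (j = k)" if "j < n" "k < n" for j k
  proof -
    consider "j = 0" | "j = N" | "j \<noteq> 0" "j \<noteq> N" by blast
    then show ?thesis
    proof cases
      case 1
      then have "(\<Sum>a<n. D j a * Y a k) = Y 0 k / v 0"
        using N by (simp add: D_def sum_divide_distrib[symmetric])
      then show ?thesis using 1 N assms(2) that(2) by (auto simp: Y_def)
    next
      case 2
      then show ?thesis using row_p[OF that(2)] N by (simp add: D_def)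
    next
      case 3
      then have "(\<Sum>a<n. D j a * Y a k) = Y j k - v j / v 0 * Y 0 k"
        using that N
        by (simp add: D_def left_diff_distrib sum_subtractf mult.assoc sum_divide_distrib[symmetric])
      then show ?thesis using 3 N assms(2) by (auto simp: Y_def)
    qed
  qed
  moreover have "\<forall>a<n. Y a 0 = v a" "\<forall>a<n. D (n - 1) a = p a" using N by (auto simp: Y_def D_def N_def)
  ultimately show ?thesis unfolding inverse_matrices_def by blast
qed

lemma exists_distinct_support:
  fixes p v :: "nat \<Rightarrow> 'k::field"
  assumes "r < n" "p r \<noteq> 0" "s < n" "v s \<noteq> 0" "(\<Sum>a<n. p a * v a) = 0"
  obtains r' s' where "r' < n" "s' < n" "r' \<noteq> s'" "p r' \<noteq> 0" "v s' \<noteq> 0"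
proof (cases "r = s")
  case True
  have "(\<Sum>a\<in>{..<n} - {r}. p a * v a) = - (p r * v r)"
    using assms(1,5) sum.remove[of "{..<n}" r "\<lambda>a. p a * v a"] by (simp add: eq_neg_iff_add_eq_0 add.commute)
  also have "\<dots> \<noteq> 0" using assms(2,4) True by simp
  finally obtain t where "t \<in> {..<n} - {r}" "p t * v t \<noteq> 0"
    by (rule sum.not_neutral_contains_not_neutral)
  then show ?thesis using that[of t s] assms True by auto
qed (use assms that in blast)

lemma inverse_matrices_with_column_and_row:
  fixes p v :: "nat \<Rightarrow> 'k::field"
  assumes "r < n" "p r \<noteq> 0" "s < n" "v s \<noteq> 0" "(\<Sum>a<n. p a * v a) = 0"
  shows "\<exists>Y D. inverse_matrices n D Y \<and> (\<forall>a<n. Y a 0 = v a) \<and> (\<forall>a<n. D (n - 1) a = p a)"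
proof -
  obtain r s where rs: "r < n" "s < n" "r \<noteq> s" "p r \<noteq> 0" "v s \<noteq> 0"
    using exists_distinct_support[OF assms] .
  define \<tau>\<^sub>1 where "\<tau>\<^sub>1 = transpose r (n - 1)"
  define \<tau>\<^sub>2 where "\<tau>\<^sub>2 = transpose 0 (\<tau>\<^sub>1 s)"
  have \<tau>\<^sub>1: "\<forall>a<n. \<tau>\<^sub>1 a < n \<and> \<tau>\<^sub>1 (\<tau>\<^sub>1 a) = a"
    unfolding \<tau>\<^sub>1_def using rs by (intro transpose_involution) auto
  then have \<tau>\<^sub>2: "\<forall>a<n. \<tau>\<^sub>2 a < n \<and> \<tau>\<^sub>2 (\<tau>\<^sub>2 a) = a"
    unfolding \<tau>\<^sub>2_def using rs by (intro transpose_involution) auto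
  have n: "0 < n - 1" using rs by linarith
  have "\<tau>\<^sub>1 s \<noteq> n - 1" using rs by (auto simp: \<tau>\<^sub>1_def transpose_def)
  then have "\<tau>\<^sub>1 (\<tau>\<^sub>2 (n - 1)) = r" using n by (simp add: \<tau>\<^sub>1_def \<tau>\<^sub>2_def transpose_def)
  moreover have "\<tau>\<^sub>1 (\<tau>\<^sub>2 0) = s" using \<tau>\<^sub>1 rs(2) by (simp add: \<tau>\<^sub>2_def)
  moreover have "(\<Sum>a<n. p (\<tau>\<^sub>1 (\<tau>\<^sub>2 a)) * v (\<tau>\<^sub>1 (\<tau>\<^sub>2 a))) = 0"
    using assms(5) sum_lessThan_involution[OF \<tau>\<^sub>2, of "\<lambda>a. p (\<tau>\<^sub>1 a) * v (\<tau>\<^sub>1 a)"]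
      sum_lessThan_involution[OF \<tau>\<^sub>1, of "\<lambda>a. p a * v a"] by simp
  ultimately obtain Y D where YD: "inverse_matrices n D Y"
    "\<forall>a<n. Y a 0 = v (\<tau>\<^sub>1 (\<tau>\<^sub>2 a))" "\<forall>a<n. D (n - 1) a = p (\<tau>\<^sub>1 (\<tau>\<^sub>2 a))"
    using inverse_matrices_normal_form[OF n, of "\<lambda>a. v (\<tau>\<^sub>1 (\<tau>\<^sub>2 a))" "\<lambda>a. p (\<tau>\<^sub>1 (\<tau>\<^sub>2 a))"] rs
    by auto
  have "inverse_matrices n (\<lambda>j a. D j (\<tau>\<^sub>2 (\<tau>\<^sub>1 a))) (\<lambda>a k. Y (\<tau>\<^sub>2 (\<tau>\<^sub>1 a)) k)"
    using inverse_matrices_relabel[OF inverse_matrices_relabel[OF YD(1) \<tau>\<^sub>2] \<tau>\<^sub>1] .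
  moreover have "\<forall>a<n. Y (\<tau>\<^sub>2 (\<tau>\<^sub>1 a)) 0 = v a" "\<forall>a<n. D (n - 1) (\<tau>\<^sub>2 (\<tau>\<^sub>1 a)) = p a"
    using YD(2,3) \<tau>\<^sub>1 \<tau>\<^sub>2 by auto
  ultimately show ?thesis by blast
qed

lemma inverse_matrices_with_column:
  fixes v :: "nat \<Rightarrow> 'k::field"
  assumes "s < n" "v s \<noteq> 0"
  shows "\<exists>Y D. inverse_matrices n D Y \<and> (\<forall>a<n. Y a 0 = v a)"
proof (cases "n = 1")
  case True
  then have "inverse_matrices n (\<lambda>_ _. 1 / v 0) (\<lambda>a _. v a)"
    using assms by (simp add: inverse_matrices_def)
  then show ?thesis by blast
next
  case False
  then obtain r where r: "r < n" "r \<noteq> s" using assms(1)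
    by (metis less_one linorder_neqE_nat not_less_zero)
  define p where "p a = (if a = r then v s else 0) - (if a = s then v r else 0)" for a
  have "(\<Sum>a<n. p a * v a)
      = (\<Sum>a<n. if a = r then v s * v r else 0) - (\<Sum>a<n. if a = s then v r * v s else 0)"
    unfolding sum_subtractf[symmetric] by (intro sum.cong) (auto simp: p_def)
  then have "(\<Sum>a<n. p a * v a) = 0"
    using r assms(1) by (simp add: mult.commute)
  then show ?thesis
    using inverse_matrices_with_column_and_row[of r n p s v] r assms by (auto simp: p_def)
qed

section \<open>The Koszul flag of a quadratic relation\<close>

lemma right_ideal_preI:
  assumes "\<forall>i<k. g i \<in> free_alg n" "h \<in> two_sided_ideal n f"
    "p = (\<lambda>w. (\<Sum>i<k. ncmul (y i) (g i) w) + h w)"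
  shows "p \<in> right_ideal_pre n f y k"
  using assms unfolding right_ideal_pre_def ncadd_def by blast

lemma right_ideal_preE:
  assumes "p \<in> right_ideal_pre n f y k"
  obtains g h where "\<forall>i<k. g i \<in> free_alg n" "h \<in> two_sided_ideal n f"
    "p = (\<lambda>w. (\<Sum>i<k. ncmul (y i) (g i) w) + h w)"
  using assms unfolding right_ideal_pre_def ncadd_def by blast

lemma two_sided_ideal_subset_right_ideal_pre:
  "two_sided_ideal n f \<subseteq> right_ideal_pre n (f::('k::comm_ring_1) ncpoly) y k"
  by (auto intro: right_ideal_preI[where g = "\<lambda>_ _. 0"])

lemma right_ideal_pre_0 [simp]: "right_ideal_pre n f y 0 = two_sided_ideal n f"
  unfolding right_ideal_pre_def ncadd_def by auto

locale quadratic_flag = dual_bases n Y D for n and Y D :: "nat \<Rightarrow> nat \<Rightarrow> 'k::field" +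
  fixes f :: "'k ncpoly"
  assumes f_free: "f \<in> free_alg n" and f_hom: "homogeneous 2 f"
begin

abbreviation ell :: "nat \<Rightarrow> 'k ncpoly" where
  "ell j \<equiv> deriv j f"

abbreviation F :: "'k ncpoly set" where
  "F \<equiv> two_sided_ideal n f"

abbreviation I :: "nat \<Rightarrow> 'k ncpoly set" where
  "I k \<equiv> right_ideal_pre n f y k"

abbreviation colon :: "nat \<Rightarrow> 'k ncpoly set" where
  "colon k \<equiv> {a \<in> free_alg n. ncmul (y k) a \<in> I k}"

lemma ell_eq_linform: "ell j = linform n (\<lambda>b. \<Sum>a<n. D j a * f [a, b])"
  using left_deriv_quadratic[OF f_free f_hom] .

lemma free_alg_ell: "ell j \<in> free_alg n"
  unfolding ell_eq_linform by (rule free_alg_linform)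

lemma f_eq_sum_y_ncmul_ell: "f = (\<lambda>w. \<Sum>j<n. ncmul (y j) (ell j) w)"
  using sum_y_ncmul_deriv[OF f_free homogeneous2_Nil[OF f_hom]] .

lemma F_subset_free_alg: "F \<subseteq> free_alg n"
  using two_sided_ideal_subset_free_alg[OF f_free] .

lemma F_subset_colon: "F \<subseteq> colon k"
  using F_subset_free_alg two_sided_ideal_ncmul_left[OF free_alg_linform]
    two_sided_ideal_subset_right_ideal_pre by blast

lemma mem_I_1:
  assumes "c \<in> free_alg n" "(\<lambda>w. a w - ncmul (y 0) c w) \<in> F"
  shows "a \<in> I 1"
  by (rule right_ideal_preI[OF _ assms(2), where g = "\<lambda>_. c"]) (use assms(1) in auto)

lemma I_1_subset_colon:
  assumes "ncmul (y k) (y 0) \<in> I k"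
  shows "I 1 \<subseteq> colon k"
proof
  fix a assume "a \<in> I 1"
  then obtain g h where g: "g 0 \<in> free_alg n" and h: "h \<in> F"
    and a: "a = (\<lambda>w. ncmul (y 0) (g 0) w + h w)"
    by (auto elim!: right_ideal_preE)
  obtain g' h' where g': "\<forall>i<k. g' i \<in> free_alg n" and h': "h' \<in> F"
    and yy: "ncmul (y k) (y 0) = (\<lambda>w. (\<Sum>i<k. ncmul (y i) (g' i) w) + h' w)"
    using assms by (rule right_ideal_preE)
  have "ncmul (y k) a
      = (\<lambda>w. (\<Sum>i<k. ncmul (y i) (ncmul (g' i) (g 0)) w) + (ncmul h' (g 0) w + ncmul (y k) h w))"
    unfolding a ncmul_add_right ncmul_assoc[symmetric] yy ncmul_add_left ncmul_sum_left
    by (simp add: ncmul_assoc add.assoc)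
  also have "\<dots> \<in> I k"
  proof (rule right_ideal_preI[OF _ _ refl])
    show "\<forall>i<k. ncmul (g' i) (g 0) \<in> free_alg n"
      using g' g by (simp add: free_alg_ncmul)
    show "(\<lambda>w. ncmul h' (g 0) w + ncmul (y k) h w) \<in> F"
      by (intro two_sided_ideal_add two_sided_ideal_ncmul_right[OF g h']
          two_sided_ideal_ncmul_left[OF free_alg_linform h])
  qed
  finally show "a \<in> colon k"
    using a g h F_subset_free_alg by (auto intro!: free_alg_add free_alg_ncmul free_alg_linform)
qed

text \<open>Apply \<open>\<partial>\<^sub>j\<close> to \<open>y\<^sub>k a = \<Sum>\<^sub>i\<^sub><\<^sub>k y\<^sub>i g\<^sub>i + h\<close>: for \<open>j = k\<close> this recovers \<open>a = \<partial>\<^sub>k h\<close>, for \<open>j > k\<close>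
  it gives \<open>\<partial>\<^sub>j h = 0\<close>; and \<open>\<partial>\<^sub>j h \<equiv> \<ell>\<^sub>j c\<close> modulo (f) with one \<open>c\<close> for all \<open>j\<close>.\<close>

lemma colonE:
  assumes "k < n" "a \<in> colon k"
  obtains c where "c \<in> free_alg n" "(\<lambda>w. a w - ncmul (ell k) c w) \<in> F"
    "\<And>j. k < j \<Longrightarrow> j < n \<Longrightarrow> ncmul (ell j) c \<in> F"
proof -
  obtain g h where g: "\<forall>i<k. g i \<in> free_alg n" and h: "h \<in> F"
    and yka: "ncmul (y k) a = (\<lambda>w. (\<Sum>i<k. ncmul (y i) (g i) w) + h w)"
    using assms(2) by (auto elim: right_ideal_preE)
  obtain c where c: "c \<in> free_alg n" "\<And>j. (\<lambda>w. deriv j h w - ncmul (ell j) c w) \<in> F"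
    using two_sided_ideal_left_deriv[OF homogeneous2_Nil[OF f_hom] h] by metis
  have deriv_yka: "deriv j (ncmul (y k) a)
      = (\<lambda>w. deriv j (\<lambda>w. \<Sum>i<k. ncmul (y i) (g i) w) w + deriv j h w)" for j
    unfolding yka left_deriv_add ..
  have "a = deriv k h"
    using deriv_yka[of k] assms(1) by (simp add: deriv_y_ncmul deriv_sum_y_ncmul)
  moreover have "deriv j h = (\<lambda>w. 0)" if "k < j" "j < n" for j
    using deriv_yka[of j] that by (simp add: deriv_y_ncmul deriv_sum_y_ncmul)
  moreover have "ncmul (ell j) c \<in> F" if "deriv j h = (\<lambda>w. 0)" for j
    using two_sided_ideal_smult[OF c(2)[of j], of "-1"] that by simp
  ultimately show ?thesis
    using that c by auto
qed

text \<open>\<open>y\<^sub>0 b \<in> (f)\<close> forces \<open>b \<equiv> \<ell>\<^sub>0 c\<close> modulo (f) with \<open>y\<^sub>0 c = \<ell>\<^sub>m c \<in> (f)\<close>, and \<open>c\<close> has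
  smaller degree than \<open>b\<close>.\<close>

lemma y0_left_regular:
  assumes "0 < m" "m < n" "ell m = y 0" "b \<in> free_alg n" "ncmul (y 0) b \<in> F"
  shows "b \<in> F"
proof -
  have parts: "homogeneous_part d b \<in> F" if "b \<in> colon 0" for d b
    using that
  proof (induction d arbitrary: b rule: less_induct)
    case (less d)
    obtain c where c: "c \<in> free_alg n" "(\<lambda>w. b w - ncmul (ell 0) c w) \<in> F"
      and c_ell: "\<And>j. 0 < j \<Longrightarrow> j < n \<Longrightarrow> ncmul (ell j) c \<in> F"
      using colonE[OF _ less.prems] assms(1,2) by auto
    have "ncmul (y 0) c \<in> F" using c_ell[OF assms(1,2)] assms(3) by simp
    have "homogeneous_part d (ncmul (ell 0) c) \<in> F"
    proof (cases d)
      case (Suc d')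
      have "homogeneous_part d' c \<in> F" using less.IH[of d' c] Suc c(1) \<open>ncmul (y 0) c \<in> F\<close> by simp
      then show ?thesis
        using Suc by (simp add: ell_eq_linform homogeneous_part_linform_ncmul
            two_sided_ideal_ncmul_left free_alg_linform)
    qed (simp add: ell_eq_linform homogeneous_part_linform_ncmul)
    moreover have "homogeneous_part d b = (\<lambda>w. homogeneous_part d (\<lambda>w. b w - ncmul (ell 0) c w) w
        + homogeneous_part d (ncmul (ell 0) c) w)"
      by (auto simp: homogeneous_part_def)
    ultimately show ?case
      using two_sided_ideal_add two_sided_ideal_homogeneous_part[OF f_hom c(2)] by metis
  qed
  show ?thesis
    by (rule two_sided_idealI_homogeneous_parts[OF assms(4) parts]) (use assms(4,5) in simp)
qed

theorem initially_koszul_wrt_isotropic: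
  assumes "0 < n - 1" "ell (n - 1) = y 0"
  shows "initially_koszul_wrt n f y"
  unfolding initially_koszul_wrt_def
proof (intro allI impI)
  fix k assume k: "k < n"
  show "\<exists>j\<le>n. colon k = I j"
  proof (cases "k = n - 1")
    case False
    have "colon k \<subseteq> I 0"
    proof
      fix a assume "a \<in> colon k"
      then obtain c where c: "c \<in> free_alg n" "(\<lambda>w. a w - ncmul (ell k) c w) \<in> F"
        and c_ell: "\<And>j. k < j \<Longrightarrow> j < n \<Longrightarrow> ncmul (ell j) c \<in> F"
        using colonE[OF k] by blast
      have kn: "k < n - 1" "n - 1 < n" using False k by auto
      from c_ell[OF kn] have "ncmul (y 0) c \<in> F" using assms(2) by simp
      then have "c \<in> F" using y0_left_regular[OF assms(1) \<open>n - 1 < n\<close> assms(2) c(1)] by simp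
      then have "ncmul (ell k) c \<in> F" by (rule two_sided_ideal_ncmul_left[OF free_alg_ell])
      with c(2) show "a \<in> I 0" using two_sided_ideal_add by fastforce
    qed
    then show ?thesis using F_subset_colon by (intro exI[of _ 0]) auto
  next
    case True
    have "colon k \<subseteq> I 1"
    proof
      fix a assume "a \<in> colon k"
      then obtain c where "c \<in> free_alg n" "(\<lambda>w. a w - ncmul (ell k) c w) \<in> F"
        by (rule colonE[OF k])
      then show "a \<in> I 1" using mem_I_1 True assms(2) by simp
    qed
    moreover have "ncmul (y k) (y 0) \<in> I k"
    proof (rule right_ideal_preI[OF _ two_sided_ideal_generator])
      show "\<forall>j<k. (\<lambda>w. - ell j w) \<in> free_alg n"
        by (simp add: free_alg_uminus free_alg_ell)
      have f_split: "f w = (\<Sum>j<k. ncmul (y j) (ell j) w) + ncmul (y k) (y 0) w" for w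
        using fun_cong[OF f_eq_sum_y_ncmul_ell, of w] True assms(2) k lessThan_Suc[of "n - 1"]
        by (simp add: add.commute)
      show "ncmul (y k) (y 0) = (\<lambda>w. (\<Sum>j<k. ncmul (y j) (\<lambda>w. - ell j w) w) + f w)"
        by (rule ext) (simp add: f_split ncmul_uminus_right sum_negf)
    qed
    ultimately show ?thesis
      using I_1_subset_colon k by (intro exI[of _ 1]) auto
  qed
qed

theorem initially_koszul_wrt_square:
  assumes "c \<noteq> 0" "0 < n" "ell 0 = (\<lambda>w. c * y 0 w)" "\<And>j. 0 < j \<Longrightarrow> j < n \<Longrightarrow> ell j = (\<lambda>w. 0)"
  shows "initially_koszul_wrt n f y"
  unfolding initially_koszul_wrt_def
proof (intro allI impI)
  fix k assume k: "k < n"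
  show "\<exists>j\<le>n. colon k = I j"
  proof (cases "k = 0")
    case False
    have "colon k \<subseteq> I 0"
    proof
      fix a assume "a \<in> colon k"
      then obtain c' where "(\<lambda>w. a w - ncmul (ell k) c' w) \<in> F"
        by (rule colonE[OF k])
      then show "a \<in> I 0" using assms(4)[OF _ k] False by simp
    qed
    then show ?thesis using F_subset_colon by (intro exI[of _ 0]) auto
  next
    case True
    have "colon k \<subseteq> I 1"
    proof
      fix a assume "a \<in> colon k"
      then obtain c' where "c' \<in> free_alg n" "(\<lambda>w. a w - ncmul (ell k) c' w) \<in> F"
        by (rule colonE[OF k])
      then show "a \<in> I 1"
        using mem_I_1[of "\<lambda>w. c * c' w"] assms(3) True
        by (simp add: free_alg_smult ncmul_smult_left ncmul_smult_right)
    qed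
    moreover have "ncmul (y k) (y 0) \<in> I k"
    proof -
      have "f w = c * ncmul (y 0) (y 0) w" for w
      proof -
        have "f w = (\<Sum>j<n. if j = 0 then ncmul (y 0) (ell 0) w else 0)"
          by (subst f_eq_sum_y_ncmul_ell) (rule sum.cong; simp add: assms(4))
        then show ?thesis using assms(2,3) by (simp add: ncmul_smult_right)
      qed
      then have "ncmul (y 0) (y 0) = (\<lambda>w. inverse c * f w)"
        using assms(1) by (simp add: field_simps)
      then show ?thesis using two_sided_ideal_smult[OF two_sided_ideal_generator] True by simp
    qed
    ultimately show ?thesis
      using I_1_subset_colon k by (intro exI[of _ 1]) auto
  qed
qed

end

section \<open>Quadratic forms over an algebraically closed field\<close>

lemma quadratic_root_exists:
  fixes c\<^sub>0 c\<^sub>1 c\<^sub>2 :: "'k::alg_closed_field"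
  assumes "c\<^sub>2 \<noteq> 0"
  shows "\<exists>t. c\<^sub>0 + c\<^sub>1 * t + c\<^sub>2 * t * t = 0"
proof -
  define g where "g i = (if i = 0 then c\<^sub>0 else if i = 1 then c\<^sub>1 else c\<^sub>2)" for i :: nat
  obtain t where "(\<Sum>k\<le>2. g k * t ^ k) = 0"
    using alg_closed[of 2 g] assms by (auto simp: g_def)
  then show ?thesis
    by (auto simp: g_def numeral_2_eq_2 power2_eq_square mult.assoc)
qed

lemma sum_two_point_combination:
  fixes n :: nat
  assumes "a < n" "b < n"
  shows "(\<Sum>x<n. (of_bool (x = b) + of_bool (x = a) * t) * g x) = g b + t * (g a :: 'k::field)"
proof -
  have "(\<Sum>x<n. (of_bool (x = b) + of_bool (x = a) * t) * g x)
      = (\<Sum>x<n. if x = b then g b else 0) + (\<Sum>x<n. if x = a then t * g a else 0)"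
    unfolding sum.distrib[symmetric] by (intro sum.cong) (auto simp: distrib_right)
  also have "\<dots> = g b + t * g a"
    using assms by simp
  finally show ?thesis .
qed

context
  fixes n :: nat and C :: "nat \<Rightarrow> nat \<Rightarrow> 'k::field"
  assumes anisotropic: "\<And>p c. (\<Sum>b<n. p b * (\<Sum>a<n. p a * C a b)) = 0 \<Longrightarrow> c < n \<Longrightarrow>
    (\<Sum>a<n. p a * C a c) = 0"
begin

lemma anisotropic_plane:
  assumes ab: "a < n" "b < n" and c: "c < n"
    and t: "C b b + (C a b + C b a) * t + C a a * t * t = 0"
  shows "C b c + t * C a c = 0"
proof -
  define p where "p x = of_bool (x = b) + of_bool (x = a) * t" for x
  have row: "(\<Sum>x<n. p x * C x c') = C b c' + t * C a c'" for c'
    unfolding p_def by (rule sum_two_point_combination[OF ab])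
  have "(\<Sum>b'<n. p b' * (\<Sum>x<n. p x * C x b')) = (\<Sum>b'<n. p b' * (C b b' + t * C a b'))"
    by (simp only: row)
  also have "\<dots> = (C b b + t * C a b) + t * (C b a + t * C a a)"
    unfolding p_def by (rule sum_two_point_combination[OF ab])
  also have "\<dots> = 0" using t by (simp add: algebra_simps)
  finally have "(\<Sum>b'<n. p b' * (\<Sum>x<n. p x * C x b')) = 0" .
  from anisotropic[of p c, OF this c] show ?thesis unfolding row .
qed

lemma anisotropic_rank_one:
  assumes a: "a < n" "C a a \<noteq> 0"
    and T: "\<And>b c. b < n \<Longrightarrow> c < n \<Longrightarrow> C b c + T b * C a c = 0"
    and bc: "b < n" "c < n"
  shows "C b c = C a b * C a c / C a a"
proof -
  define t where "t = - (C a b / C a a)"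
  define \<kappa> where "\<kappa> = - T b + t"
  have row: "C b c' + t * C a c' = \<kappa> * C a c'" if "c' < n" for c'
    using T[OF bc(1) that] unfolding \<kappa>_def by (simp add: algebra_simps)
  have "C b b + (C a b + C b a) * t + C a a * t * t = (C b b + t * C a b) + t * (C b a + t * C a a)"
    by (simp add: algebra_simps)
  also have "\<dots> = \<kappa> * C a b + t * (\<kappa> * C a a)" by (simp only: row bc(1) a(1))
  also have "\<dots> = \<kappa> * (C a b + t * C a a)" by (simp add: algebra_simps)
  also have "\<dots> = 0" using a(2) by (simp add: t_def)
  finally have "\<kappa> * C a a = 0" using anisotropic_plane[OF a(1) bc(1) a(1)] row[OF a(1)] by simp
  then have "\<kappa> = 0" using a(2) by simp
  then show ?thesis using row[OF bc(2)] a(2) by (simp add: t_def field_simps)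
qed

end

text \<open>In the plane of any two coordinate vectors the form \<open>p\<^sup>T C p\<close> has an isotropic vector, since
  the field is algebraically closed.  If all isotropic vectors lie in the left kernel of \<open>C\<close>, this
  makes every row a multiple of a row \<open>l\<close> with \<open>l\<^sub>a \<noteq> 0\<close>, and then \<open>C = l l\<^sup>T / l\<^sub>a\<close>.\<close>

lemma isotropic_or_rank_one:
  fixes C :: "nat \<Rightarrow> nat \<Rightarrow> 'k::alg_closed_field"
  assumes "a\<^sub>0 < n" "b\<^sub>0 < n" "C a\<^sub>0 b\<^sub>0 \<noteq> 0"
  obtains (isotropic) p where "\<exists>b<n. (\<Sum>a<n. p a * C a b) \<noteq> 0"
      "(\<Sum>b<n. p b * (\<Sum>a<n. p a * C a b)) = 0"
  | (rank_one) l a where "a < n" "l a \<noteq> 0" "\<And>b c. b < n \<Longrightarrow> c < n \<Longrightarrow> C b c = l b * l c / l a"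
proof (cases "\<exists>p. (\<exists>b<n. (\<Sum>a<n. p a * C a b) \<noteq> 0) \<and> (\<Sum>b<n. p b * (\<Sum>a<n. p a * C a b)) = 0")
  case True
  then show ?thesis using isotropic by blast
next
  case False
  then have anisotropic: "(\<Sum>a<n. p a * C a c) = 0"
    if "(\<Sum>b<n. p b * (\<Sum>a<n. p a * C a b)) = 0" "c < n" for p c
    using that by blast
  obtain a where a: "a < n" "C a a \<noteq> 0"
  proof (cases "C a\<^sub>0 a\<^sub>0 = 0")
    case True
    then have "C a\<^sub>0 b\<^sub>0 = 0"
      using anisotropic_plane[OF anisotropic assms(1,1,2), where t = 0] by simp
    with assms(3) show ?thesis by simp
  qed (use assms(1) in blast)
  have "\<forall>b\<in>{..<n}. \<exists>t. \<forall>c<n. C b c + t * C a c = 0"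
  proof
    fix b assume b: "b \<in> {..<n}"
    obtain t where t: "C b b + (C a b + C b a) * t + C a a * t * t = 0"
      using quadratic_root_exists[OF a(2)] by blast
    have "C b c + t * C a c = 0" if "c < n" for c
      using anisotropic_plane[OF anisotropic a(1) _ that t] b by simp
    then show "\<exists>t. \<forall>c<n. C b c + t * C a c = 0" by blast
  qed
  then have "\<exists>T. \<forall>b\<in>{..<n}. \<forall>c<n. C b c + T b * C a c = 0"
    by (rule bchoice)
  then obtain T where T: "\<And>b c. b < n \<Longrightarrow> c < n \<Longrightarrow> C b c + T b * C a c = 0" by blast
  have "C b c = C a b * C a c / C a a" if "b < n" "c < n" for b c
    by (rule anisotropic_rank_one[where n = n and C = C, OF anisotropic a T that])
  then show ?thesis by (rule rank_one[of a "C a", OF a])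
qed

lemma initially_koszul_isotropic:
  fixes f :: "('k::field) ncpoly"
  assumes f: "f \<in> free_alg n" "homogeneous 2 f"
    and v: "\<And>b. v b = (\<Sum>a<n. p a * f [a, b])" "s < n" "v s \<noteq> 0"
    and p: "r < n" "p r \<noteq> 0" "(\<Sum>b<n. p b * v b) = 0"
  shows "initially_koszul n f"
proof -
  obtain r' s' where "r' < n" "s' < n" "r' \<noteq> s'"
    using exists_distinct_support[OF p(1,2) v(2,3) p(3)] by blast
  then have n: "0 < n - 1" by linarith
  obtain Y D where YD: "inverse_matrices n D Y" "\<forall>a<n. Y a 0 = v a" "\<forall>a<n. D (n - 1) a = p a"
    using inverse_matrices_with_column_and_row[OF p(1,2) v(2,3) p(3)] by blast
  interpret quadratic_flag n Y D f
    by unfold_locales (use YD(1) f in auto)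
  have "ell (n - 1) = y 0"
    unfolding ell_eq_linform using YD(2,3) v(1) by (intro linform_cong) simp
  then have "initially_koszul_wrt n f y"
    by (rule initially_koszul_wrt_isotropic[OF n])
  then show ?thesis
    unfolding initially_koszul_def using degree_one_basis by blast
qed

lemma initially_koszul_rank_one:
  fixes f :: "('k::field) ncpoly"
  assumes f: "f \<in> free_alg n" "homogeneous 2 f"
    and l: "a < n" "l a \<noteq> 0" "\<And>b c. b < n \<Longrightarrow> c < n \<Longrightarrow> f [b, c] = l b * l c / l a"
  shows "initially_koszul n f"
proof -
  obtain Y D where YD: "inverse_matrices n D Y" "\<forall>b<n. Y b 0 = l b"
    using inverse_matrices_with_column[of a n l] l(1,2) by blast
  interpret quadratic_flag n Y D f
    by unfold_locales (use YD(1) f in auto)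
  have ell: "ell j = linform n (\<lambda>b. of_bool (j = 0) * (inverse (l a) * Y b 0))" if "j < n" for j
  proof -
    have "(\<Sum>i<n. D j i * f [i, b]) = (\<Sum>i<n. D j i * Y i 0) * (inverse (l a) * Y b 0)"
      if "b < n" for b
    proof -
      have "(\<Sum>i<n. D j i * f [i, b]) = (\<Sum>i<n. D j i * Y i 0 * (inverse (l a) * Y b 0))"
        using YD(2) l(3) that by (intro sum.cong) (auto simp: field_simps)
      then show ?thesis by (simp add: sum_distrib_right)
    qed
    then show ?thesis
      unfolding ell_eq_linform using D_Y \<open>j < n\<close> l(1)
      by (intro linform_cong) (simp add: inverse_matrices_def)
  qed
  have "initially_koszul_wrt n f y"
  proof (rule initially_koszul_wrt_square)
    show "ell 0 = (\<lambda>w. inverse (l a) * y 0 w)"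
      using ell[of 0] l(1) by (simp add: linform_smult)
    show "ell j = (\<lambda>w. 0)" if "0 < j" "j < n" for j
      using ell[OF that(2)] that(1) by (simp add: linform_zero)
  qed (use l in auto)
  then show ?thesis
    unfolding initially_koszul_def using degree_one_basis by blast
qed

theorem mainTheorem8:
  fixes f :: "('k::alg_closed_field) ncpoly" and n :: nat
  assumes "f \<in> free_alg n" and "f \<noteq> (\<lambda>w. 0)" and "homogeneous 2 f"
  shows "initially_koszul n f"
proof -
  obtain a\<^sub>0 b\<^sub>0 where ab: "a\<^sub>0 < n" "b\<^sub>0 < n" "f [a\<^sub>0, b\<^sub>0] \<noteq> 0"
    using assms homogeneous2_support[OF assms(1,3)] by fastforce
  from ab show ?thesis
  proof (cases rule: isotropic_or_rank_one[where C = "\<lambda>a b. f [a, b]"])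
    case (isotropic p)
    then obtain s where s: "s < n" "(\<Sum>a<n. p a * f [a, s]) \<noteq> 0" by blast
    then obtain r where "r < n" "p r \<noteq> 0"
      by (metis (no_types, lifting) mult_eq_0_iff sum.neutral lessThan_iff)
    then show ?thesis
      using initially_koszul_isotropic[OF assms(1,3) refl s] isotropic(2) by blast
  next
    case (rank_one l a)
    then show ?thesis by (rule initially_koszul_rank_one[OF assms(1,3)])
  qed
qed

end
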